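(* Let $|x|+|y|<1$, $\Re(\gamma)>\Re(\beta)>0$, $\Re(\gamma')>\Re(\beta')>0$, $\Re(b)\ge0$, and write $\mathbf{F}_2^{(\kappa_l)}(\cdots;x,y;b)=\mathbf{F}_2^{(\kappa_l)}(\cdots;x,y;b,b)$ (the case $d=b$). Then $$ \mathbf{F}_{2}^{(\kappa_l)}(\alpha,\beta,\beta';\gamma,\gamma';x,y;b)=(1-x)^{-\alpha}\,\mathbf{F}_{2}^{(\kappa_l)}\left(\alpha,\gamma-\beta,\beta';\gamma,\gamma';\frac{x}{x-1},\frac{-y}{x-1};b\right), $$ $$ \mathbf{F}_{2}^{(\kappa_l)}(\alpha,\beta,\beta';\gamma,\gamma';x,y;b)=(1-y)^{-\alpha}\,\mathbf{F}_{2}^{(\kappa_l)}\left(\alpha,\beta,\gamma'-\beta';\gamma,\gamma';\frac{-x}{y-1},\frac{y}{y-1};b\right), $$ $$ \mathbf{F}_{2}^{(\kappa_l)}(\alpha,\beta,\beta';\gamma,\gamma';x,y;b)=(1-x-y)^{-\alpha}\,\mathbf{F}_{2}^{(\kappa_l)}\left(\alpha,\gamma-\beta,\gamma'-\beta';\gamma,\gamma';\frac{-x}{1-x-y},\frac{-y}{1-x-y};b\right). $$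
   Context: Here $(a)_m=\Gamma(a+m)/\Gamma(a)$ is the Pochhammer symbol and $B(\cdot,\cdot)$ is Euler's beta function. Let $\{\kappa_l\}_{l\ge0}$ be a complex sequence with $\kappa_0=1$ and let $\Theta(z)=\Theta(\kappa_l;z)$ be a function analytic in a disk $|z|<R$ ($0<R<\infty$) with $\Theta(z)=\sum_{l\ge0}\kappa_l z^l/l!$ there, continued analytically to the half-plane $\Re(z)>0$ with $\Theta(z)=M_0z^{\omega}e^{z}[1+O(1/z)]$ as $\Re(z)\to\infty$ ($M_0>0$, $\omega\in\mathbb{C}$). It is also understood that $\Theta$ is defined and continuous on $\Re(z)\le 0$ and that the following integrals converge absolutely. For $\Re(b),\Re(d)\ge0$ and $\Re(\alpha),\Re(\beta)>0$, $$\mathcal{B}^{(\kappa_l)}_{b,d}(\alpha,\beta)=\int_0^1t^{\alpha-1}(1-t)^{\beta-1}\Theta\left(-\frac bt-\frac d{1-t}\right)dt .$$ The extended Appell function $\mathbf{F}_2^{(\kappa_l)}$ is, for $|x|+|y|<1$ and $\Re(\gamma_i)>\Re(\beta_i)>0$ ($i=1,2$), $$\mathbf{F}_{2}^{(\kappa_l)}(\alpha,\beta_1,\beta_2;\gamma_1,\gamma_2;x,y;b,d)=\sum_{m,n=0}^\infty(\alpha)_{m+n}\frac{\mathcal{B}^{(\kappa_l)}_{b,d}(\beta_1+m,\gamma_1-\beta_1)\,\mathcal{B}^{(\kappa_l)}_{b,d}(\beta_2+n,\gamma_2-\beta_2)}{B(\beta_1,\gamma_1-\beta_1)B(\beta_2,\gamma_2-\beta_2)}\frac{x^my^n}{m!\,n!},$$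 and for other $(x,y)$ such that $1-xt-ys\neq0$ for all $(t,s)\in[0,1]^2$ it is given by its integral representation $$\frac{1}{B(\beta_1,\gamma_1-\beta_1)B(\beta_2,\gamma_2-\beta_2)}\int_0^1\!\!\int_0^1\frac{t^{\beta_1-1}(1-t)^{\gamma_1-\beta_1-1}s^{\beta_2-1}(1-s)^{\gamma_2-\beta_2-1}}{(1-xt-ys)^{\alpha}}\Theta\left(-\frac bt-\frac d{1-t}\right)\Theta\left(-\frac bs-\frac d{1-s}\right)dt\,ds ,$$ the power $(1-xt-ys)^{\alpha}$ being the branch continuous on $[0,1]^2$ with value $1$ at $t=s=0$. The prefactors $(1-x)^{-\alpha}$ etc. are principal powers. *)

theory Defs
  imports "HOL-Analysis.Analysis" "HOL-Library.Landau_Symbols"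
begin

text \<open>
  The kernel \<open>\<Theta>\<close> is a parameter of all definitions. The sequence \<open>\<kappa>\<close> only enters through the
  hypothesis that \<open>\<Theta>\<close> has the exponential generating series of \<open>\<kappa>\<close> near the origin.
\<close>

definition ext_beta_integrand ::
  "(complex \<Rightarrow> complex) \<Rightarrow> complex \<Rightarrow> complex \<Rightarrow> complex \<Rightarrow> complex \<Rightarrow> real \<Rightarrow> complex" where
  "ext_beta_integrand \<Theta> b d \<alpha> \<beta> t =
     of_real t powr (\<alpha> - 1) * of_real (1 - t) powr (\<beta> - 1)
       * \<Theta> (- (b / of_real t) - d / of_real (1 - t))"

definition ext_beta ::
  "(complex \<Rightarrow> complex) \<Rightarrow> complex \<Rightarrow> complex \<Rightarrow> complex \<Rightarrow> complex \<Rightarrow> complex" where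
  "ext_beta \<Theta> b d \<alpha> \<beta> = (LBINT t:{0<..<1}. ext_beta_integrand \<Theta> b d \<alpha> \<beta> t)"

definition appell_nonvanishing :: "complex \<Rightarrow> complex \<Rightarrow> bool" where
  "appell_nonvanishing x y \<longleftrightarrow>
     (\<forall>(t, s) \<in> {0..1} \<times> {0..1}. 1 - x * of_real t - y * of_real s \<noteq> 0)"

text \<open>
  Branches of \<open>log (1 - x t - y s)\<close> that are continuous on the unit square and vanish at
  \<open>t = s = 0\<close>. Under \<open>appell_nonvanishing x y\<close> such a branch exists and is unique on the square
  (both facts are proved below), so the choice in \<open>appell_power\<close> is well defined.
\<close>

definition appell_log_branch :: "complex \<Rightarrow> complex \<Rightarrow> (real \<times> real \<Rightarrow> complex) \<Rightarrow> bool" where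
  "appell_log_branch x y L \<longleftrightarrow>
     continuous_on ({0..1} \<times> {0..1}) L \<and> L (0, 0) = 0 \<and>
     (\<forall>(t, s) \<in> {0..1} \<times> {0..1}. exp (L (t, s)) = 1 - x * of_real t - y * of_real s)"

definition appell_power :: "complex \<Rightarrow> complex \<Rightarrow> complex \<Rightarrow> real \<Rightarrow> real \<Rightarrow> complex" where
  "appell_power \<alpha> x y t s = exp (\<alpha> * (SOME L. appell_log_branch x y L) (t, s))"

lemma appell_log_branch_Ln:
  assumes nv: "appell_nonvanishing x y"
  shows "appell_log_branch x y (\<lambda>(t, s). Ln (1 - x * of_real t - y * of_real s))"
proof -
  define S :: "(real \<times> real) set" where "S = {0..1} \<times> {0..1}"
  define f where "f = (\<lambda>p::real \<times> real. 1 - x * of_real (fst p) - y * of_real (snd p))"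
  have nz: "f p \<noteq> 0" if "p \<in> S" for p
    using nv that unfolding appell_nonvanishing_def S_def f_def by (auto simp: mem_Times_iff)
  have notneg: "f p \<notin> \<real>\<^sub>\<le>\<^sub>0" if p: "p \<in> S" for p
  proof
    assume "f p \<in> \<real>\<^sub>\<le>\<^sub>0"
    then obtain r where r: "f p = of_real r" "r \<le> 0" by (auto elim: nonpos_Reals_cases)
    define c where "c = 1 / (1 - r)"
    have c: "0 \<le> c" "c \<le> 1" "1 - c * (1 - r) = 0" using r(2) by (auto simp: c_def field_simps)
    have "c *\<^sub>R p \<in> S"
      using p c by (auto simp: S_def mem_Times_iff intro: mult_le_one)
    moreover have "f (c *\<^sub>R p) = 1 - of_real c * (1 - f p)"
      by (simp add: f_def algebra_simps)
    then have "f (c *\<^sub>R p) = of_real (1 - c * (1 - r))" using r(1) by simp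
    ultimately show False using nz c(3) by (metis of_real_0)
  qed
  have "continuous_on S (\<lambda>p. Ln (f p))"
    unfolding f_def by (intro continuous_intros) (use notneg in \<open>auto simp: f_def\<close>)
  moreover have "(\<lambda>(t, s). Ln (1 - x * of_real t - y * of_real s)) = (\<lambda>p. Ln (f p))"
    by (auto simp: f_def)
  ultimately show ?thesis
    using nz unfolding appell_log_branch_def S_def[symmetric] by (auto simp: f_def)
qed

lemma appell_log_branch_unique:
  assumes "appell_log_branch x y L" "appell_log_branch x y L'" "p \<in> {0..1} \<times> {0..1}"
  shows "L p = L' p"
proof -
  define S :: "(real \<times> real) set" where "S = {0..1} \<times> {0..1}"
  have cont: "continuous_on S (\<lambda>p. L p - L' p)"
    using assms unfolding appell_log_branch_def S_def by (intro continuous_intros) auto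
  have conn: "connected S" unfolding S_def by (intro convex_connected convex_Times) auto
  have e1: "exp (L q - L' q) = 1" if "q \<in> S" for q
  proof -
    have "exp (L q) = exp (L' q)"
      using assms(1,2) that unfolding appell_log_branch_def S_def by (cases q) auto
    then show ?thesis by (simp add: exp_diff)
  qed
  have "(\<lambda>p. L p - L' p) constant_on S"
  proof (rule continuous_discrete_range_constant[OF conn cont])
    fix q assume q: "q \<in> S"
    show "\<exists>e>0. \<forall>r. r \<in> S \<and> L r - L' r \<noteq> L q - L' q \<longrightarrow> e \<le> norm (L r - L' r - (L q - L' q))"
    proof (intro exI[of _ "2 * pi"] conjI allI impI)
      fix r assume r: "r \<in> S \<and> L r - L' r \<noteq> L q - L' q"
      define z where "z = L r - L' r - (L q - L' q)"
      have "exp z = 1" unfolding z_def using e1[of r] e1[OF q] r by (simp add: exp_diff)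
      then obtain n :: int where n: "Re z = 0" "Im z = of_int (2 * n) * pi"
        by (auto simp: exp_eq_1)
      have "z \<noteq> 0" using r by (simp add: z_def)
      then have "n \<noteq> 0" using n by (auto simp: complex_eq_iff)
      then have "1 \<le> \<bar>real_of_int n\<bar>" by linarith
      then have "2 * pi \<le> \<bar>Im z\<bar>" by (simp add: n abs_mult)
      also have "\<dots> \<le> norm z" by (rule abs_Im_le_cmod)
      finally show "2 * pi \<le> norm (L r - L' r - (L q - L' q))" by (simp add: z_def)
    qed simp
  qed
  then obtain c where c: "\<And>q. q \<in> S \<Longrightarrow> L q - L' q = c" by (auto simp: constant_on_def)
  have "c = 0" using c[of "(0, 0)"] assms(1,2) by (auto simp: S_def appell_log_branch_def)
  then show ?thesis using c[of p] assms(3) by (simp add: S_def)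
qed

text \<open>
  The double series is an unordered sum over all pairs \<open>(m, n)\<close>. Outside \<open>|x| + |y| < 1\<close> the value is
  meaningful only under \<open>appell_nonvanishing x y\<close>.
\<close>

definition ext_appell_F2 ::
  "(complex \<Rightarrow> complex) \<Rightarrow> complex \<Rightarrow> complex \<Rightarrow> complex \<Rightarrow> complex \<Rightarrow> complex
    \<Rightarrow> complex \<Rightarrow> complex \<Rightarrow> complex \<Rightarrow> complex \<Rightarrow> complex" where
  "ext_appell_F2 \<Theta> \<alpha> \<beta>\<^sub>1 \<beta>\<^sub>2 \<gamma>\<^sub>1 \<gamma>\<^sub>2 x y b d =
     (if norm x + norm y < 1 then
        (\<Sum>\<^sub>\<infinity>(m, n) \<in> (UNIV :: (nat \<times> nat) set).
           pochhammer \<alpha> (m + n)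
           * (ext_beta \<Theta> b d (\<beta>\<^sub>1 + of_nat m) (\<gamma>\<^sub>1 - \<beta>\<^sub>1) * ext_beta \<Theta> b d (\<beta>\<^sub>2 + of_nat n) (\<gamma>\<^sub>2 - \<beta>\<^sub>2))
             / (Beta \<beta>\<^sub>1 (\<gamma>\<^sub>1 - \<beta>\<^sub>1) * Beta \<beta>\<^sub>2 (\<gamma>\<^sub>2 - \<beta>\<^sub>2))
           * (x ^ m * y ^ n / (fact m * fact n)))
      else
        1 / (Beta \<beta>\<^sub>1 (\<gamma>\<^sub>1 - \<beta>\<^sub>1) * Beta \<beta>\<^sub>2 (\<gamma>\<^sub>2 - \<beta>\<^sub>2))
        * (LINT (t, s):{0<..<1} \<times> {0<..<1}|lborel.
             of_real t powr (\<beta>\<^sub>1 - 1) * of_real (1 - t) powr (\<gamma>\<^sub>1 - \<beta>\<^sub>1 - 1)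
             * of_real s powr (\<beta>\<^sub>2 - 1) * of_real (1 - s) powr (\<gamma>\<^sub>2 - \<beta>\<^sub>2 - 1)
             / appell_power \<alpha> x y t s
             * \<Theta> (- (b / of_real t) - d / of_real (1 - t))
             * \<Theta> (- (b / of_real s) - d / of_real (1 - s))))"

end

theory Submission
  imports Defs
begin

text \<open>
  Both branches of the definition of the extended \<open>F\<^sub>2\<close> have the same Euler integral
  representation: on \<open>|x| + |y| < 1\<close> the binomial expansion of \<open>(1 - x t - y s)\<close> to the power
  \<open>-\<alpha>\<close> converges absolutely, uniformly on the unit square, and may be integrated termwise against
  the two beta weights; elsewhere the continuous branch of the power is the principal one. Since
  \<open>d = b\<close>, the reflection \<open>t \<rightarrow> 1 - t\<close> only swaps the two exponents of a beta weight, while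
  \<open>1 - x (1 - t) - y s = (1 - x) (1 - x' t - y' s)\<close> with \<open>x' = x / (x - 1)\<close> and
  \<open>y' = -y / (x - 1)\<close>. The power splits along this factorisation because \<open>1 - x\<close> and
  \<open>1 - x (1 - t) - y s\<close> both have positive real part. Reflecting \<open>s\<close>, or both variables, gives the
  other two formulas.
\<close>

section \<open>Principal powers and the continuous branch\<close>

text \<open>The arguments of \<open>c\<close> and \<open>c * w\<close> both lie within pi/2 of 0, so
  \<open>Ln (c * w) - Ln c\<close> has imaginary part in (-pi, pi) and is the principal logarithm of
  \<open>w\<close>. The factor \<open>w\<close> itself may lie in the left half-plane.\<close>

lemma powr_mult_Re_pos:
  fixes c w a :: complex
  assumes "Re c > 0" "Re (c * w) > 0"
  shows "(c * w) powr a = c powr a * w powr a"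
proof -
  have nz: "c \<noteq> 0" "w \<noteq> 0" "c * w \<noteq> 0" using assms by auto
  have "\<bar>Im (Ln c)\<bar> < pi / 2" "\<bar>Im (Ln (c * w))\<bar> < pi / 2"
    using Re_Ln_pos_lt nz assms by blast+
  then have "Ln w = Ln (c * w) - Ln c"
    by (intro Ln_unique) (use nz in \<open>auto simp: exp_diff abs_if split: if_splits\<close>)
  then have "Ln (c * w) = Ln c + Ln w" by simp
  then show ?thesis
    using nz by (simp add: powr_def exp_add distrib_left)
qed

lemma Re_one_minus_pos:
  fixes x y :: complex and t s :: real
  assumes "norm x + norm y < 1" "t \<in> {0..1}" "s \<in> {0..1}"
  shows "Re (1 - x * of_real t - y * of_real s) > 0"
proof -
  have "norm (x * of_real t + y * of_real s) \<le> norm x * \<bar>t\<bar> + norm y * \<bar>s\<bar>"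
    by (rule order.trans[OF norm_triangle_ineq]) (simp add: norm_mult)
  also have "\<dots> \<le> norm x * 1 + norm y * 1"
    using assms by (intro add_mono mult_left_mono) auto
  finally have "norm (x * of_real t + y * of_real s) < 1" using assms by simp
  then have "Re (x * of_real t + y * of_real s) < 1"
    using complex_Re_le_cmod[of "x * of_real t + y * of_real s"] by linarith
  then show ?thesis by simp
qed

lemma appell_nonvanishing_unit:
  assumes "norm x + norm y < 1"
  shows "appell_nonvanishing x y"
  unfolding appell_nonvanishing_def
proof safe
  fix t s :: real
  assume "t \<in> {0..1}" "s \<in> {0..1}" "1 - x * of_real t - y * of_real s = 0"
  then show False using Re_one_minus_pos[OF assms, of t s] by simp
qed

text \<open>The principal logarithm is one admissible branch, and branches are unique on the closed
  square, so the choice operator in \<open>appell_power\<close> must agree with it there.\<close>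

lemma appell_power_eq_powr:
  assumes nv: "appell_nonvanishing x y" and ts: "t \<in> {0..1}" "s \<in> {0..1}"
  shows "appell_power \<alpha> x y t s = (1 - x * of_real t - y * of_real s) powr \<alpha>"
proof -
  define L where "L = (\<lambda>(t::real, s::real). Ln (1 - x * of_real t - y * of_real s))"
  have L: "appell_log_branch x y L"
    unfolding L_def by (rule appell_log_branch_Ln[OF nv])
  then have "appell_log_branch x y (SOME L. appell_log_branch x y L)" by (rule someI[where P = "appell_log_branch x y"])
  then have "(SOME L. appell_log_branch x y L) (t, s) = L (t, s)"
    using L by (rule appell_log_branch_unique) (use ts in auto)
  moreover have "1 - x * of_real t - y * of_real s \<noteq> 0"
    using nv ts by (auto simp: appell_nonvanishing_def)
  ultimately show ?thesis by (simp add: appell_power_def L_def powr_def)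
qed

section \<open>The binomial series in one and two variables\<close>

lemma sums_one_minus_powr:
  fixes \<alpha> z :: complex
  assumes "norm z < 1"
  shows "(\<lambda>k. pochhammer \<alpha> k * z ^ k / fact k) sums (1 - z) powr (-\<alpha>)"
proof -
  have "(\<lambda>k. ((-\<alpha>) gchoose k) * (-z) ^ k) sums (1 + -z) powr (-\<alpha>)"
    using assms by (intro gen_binomial_complex) auto
  moreover have "((-\<alpha>) gchoose k) * (-z) ^ k = pochhammer \<alpha> k * z ^ k / fact k" for k
  proof -
    have "(- 1) ^ k * (- z) ^ k = z ^ k" by (simp flip: power_mult_distrib)
    moreover have "((-\<alpha>) gchoose k) * (-z) ^ k = pochhammer \<alpha> k / fact k * ((- 1) ^ k * (- z) ^ k)"
      by (simp only: gbinomial_pochhammer minus_minus divide_inverse mult_ac)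
    ultimately show ?thesis by (simp only: times_divide_eq_left)
  qed
  ultimately show ?thesis by simp
qed

lemma summable_norm_pochhammer_power:
  fixes \<alpha> :: complex
  assumes "0 \<le> r" "r < 1"
  shows "summable (\<lambda>k. norm (pochhammer \<alpha> k) * r ^ k / fact k)"
proof -
  \<comment> \<open>Convergence at a slightly larger radius \<open>q\<close> forces absolute
    convergence at \<open>r\<close>.\<close>
  obtain q where q: "r < q" "q < 1" using dense assms(2) by blast
  have "summable (\<lambda>k. (pochhammer \<alpha> k / fact k) * of_real q ^ k)"
    using sums_summable[OF sums_one_minus_powr[of "of_real q" \<alpha>]] q assms by simp
  then have "summable (\<lambda>k. norm ((pochhammer \<alpha> k / fact k) * of_real r ^ k))"
    by (rule powser_insidea) (use q assms in auto)
  then show ?thesis using assms by (simp add: norm_mult norm_divide norm_power)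
qed

text \<open>Groups the index pairs by total degree \<open>k = m + n\<close>, which reduces the
  double series to a power series in one variable. The natural subtraction is exact because
  \<open>m \<le> k\<close>.\<close>

lemma bij_betw_antidiagonals:
  "bij_betw (\<lambda>(k, m). (m, k - m)) (SIGMA k:UNIV. {..k}) (UNIV :: (nat \<times> nat) set)"
  by (rule bij_betwI[where g = "\<lambda>(m, n). (m + n, m)"]) auto

lemma sum_antidiagonal_binomial:
  fixes z w :: "'a::field_char_0"
  shows "(\<Sum>m\<le>k. z ^ m * w ^ (k - m) / (fact m * fact (k - m))) = (z + w) ^ k / fact k"
  unfolding binomial_ring sum_divide_distrib
  by (intro sum.cong) (simp_all add: binomial_fact)

text \<open>By the binomial theorem, the norms on the antidiagonal of degree \<open>k\<close> add up
  to the degree \<open>k\<close> term of a power series at \<open>norm z + norm w\<close>; hence the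
  hypothesis bounds this sum rather than \<open>norm (z + w)\<close>.\<close>

lemma abs_summable_appell_kernel:
  fixes \<alpha> z w :: complex
  assumes "norm z + norm w < 1"
  shows "(\<lambda>q. norm (case q of (m, n) \<Rightarrow> pochhammer \<alpha> (m + n) * (z ^ m * w ^ n / (fact m * fact n))))
           summable_on UNIV"
    (is "(\<lambda>q. norm (?f q)) summable_on _")
proof -
  have "(\<lambda>q. norm (?f ((\<lambda>(k, m). (m, k - m)) q))) summable_on (SIGMA k:UNIV. {..k})"
  proof (rule summable_on_SigmaI)
    fix k :: nat
    have "(\<Sum>m\<le>k. norm (?f ((\<lambda>(k, m). (m, k - m)) (k, m))))
        = norm (pochhammer \<alpha> k)
            * (\<Sum>m\<le>k. norm z ^ m * norm w ^ (k - m) / (fact m * fact (k - m)))"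
      unfolding sum_distrib_left
      by (intro sum.cong) (auto simp: norm_mult norm_divide norm_power)
    also have "\<dots> = norm (pochhammer \<alpha> k) * (norm z + norm w) ^ k / fact k"
      by (simp add: sum_antidiagonal_binomial)
    finally show "((\<lambda>m. norm (?f ((\<lambda>(k, m). (m, k - m)) (k, m)))) has_sum
        norm (pochhammer \<alpha> k) * (norm z + norm w) ^ k / fact k) {..k}"
      by (rule has_sum_finiteI[OF finite_atMost sym])
  next
    show "(\<lambda>k. norm (pochhammer \<alpha> k) * (norm z + norm w) ^ k / fact k) summable_on UNIV"
      by (subst summable_on_UNIV_nonneg_real_iff)
         (use assms in \<open>auto intro!: summable_norm_pochhammer_power\<close>)
  qed auto
  then show ?thesis
    by (subst (asm) summable_on_reindex_bij_betw[OF bij_betw_antidiagonals, of "\<lambda>q. norm (?f q)"])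
qed

text \<open>The same grouping without norms gives the binomial series at
  \<open>z + w\<close>.\<close>

lemma has_sum_appell_kernel:
  fixes \<alpha> z w :: complex
  assumes "norm z + norm w < 1"
  shows "((\<lambda>(m, n). pochhammer \<alpha> (m + n) * (z ^ m * w ^ n / (fact m * fact n)))
            has_sum (1 - z - w) powr (-\<alpha>)) UNIV"
    (is "(?f has_sum _) _")
proof -
  have lt: "norm (z + w) < 1"
    using norm_triangle_ineq[of z w] assms by linarith
  have "((\<lambda>q. ?f ((\<lambda>(k, m). (m, k - m)) q)) has_sum (1 - (z + w)) powr (-\<alpha>))
          (SIGMA k:UNIV. {..k})"
  proof (rule has_sum_SigmaI)
    fix k :: nat
    have "(\<Sum>m\<le>k. ?f ((\<lambda>(k, m). (m, k - m)) (k, m)))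
        = pochhammer \<alpha> k * (\<Sum>m\<le>k. z ^ m * w ^ (k - m) / (fact m * fact (k - m)))"
      unfolding sum_distrib_left by (intro sum.cong) auto
    also have "\<dots> = pochhammer \<alpha> k * (z + w) ^ k / fact k"
      by (simp add: sum_antidiagonal_binomial)
    finally show "((\<lambda>m. ?f ((\<lambda>(k, m). (m, k - m)) (k, m))) has_sum
        pochhammer \<alpha> k * (z + w) ^ k / fact k) {..k}"
      by (rule has_sum_finiteI[OF finite_atMost sym])
  next
    have "summable (\<lambda>k. norm (pochhammer \<alpha> k * (z + w) ^ k / fact k))"
      using summable_norm_pochhammer_power[of "norm (z + w)" \<alpha>] lt
      by (simp add: norm_mult norm_divide norm_power)
    then show "((\<lambda>k. pochhammer \<alpha> k * (z + w) ^ k / fact k) has_sum (1 - (z + w)) powr (-\<alpha>)) UNIV"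
      by (rule norm_summable_imp_has_sum) (rule sums_one_minus_powr[OF lt])
  next
    \<comment> \<open>Passing from iterated sums to the unordered double sum requires summability
      over all pairs.\<close>
    have "?f summable_on UNIV"
      by (rule abs_summable_summable[OF abs_summable_appell_kernel[OF assms]])
    then show "(\<lambda>q. ?f ((\<lambda>(k, m). (m, k - m)) q)) summable_on (SIGMA k:UNIV. {..k})"
      by (subst summable_on_reindex_bij_betw[OF bij_betw_antidiagonals])
  qed
  then show ?thesis
    by (subst (asm) has_sum_reindex_bij_betw[OF bij_betw_antidiagonals]) (simp add: diff_diff_eq)
qed

section \<open>Termwise integration of the Euler integral\<close>

lemma
  fixes f g :: "real \<Rightarrow> complex"
  assumes f: "integrable lborel f" and g: "integrable lborel g"
  shows integrable_lborel_times: "integrable lborel (\<lambda>p. f (fst p) * g (snd p))"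
    and integral_lborel_times:
      "(LINT p|lborel. f (fst p) * g (snd p)) = (LINT t|lborel. f t) * (LINT s|lborel. g s)"
proof -
  have [measurable]: "f \<in> borel_measurable borel" "g \<in> borel_measurable borel"
    using f g by (auto dest: borel_measurable_integrable)
  have int: "integrable (lborel \<Otimes>\<^sub>M lborel) (\<lambda>p. f (fst p) * g (snd p))"
    by (rule lborel_pair.Fubini_integrable) (use f g in \<open>auto simp: norm_mult\<close>)
  then show "integrable lborel (\<lambda>p. f (fst p) * g (snd p))" by (simp add: lborel_prod)
  show "(LINT p|lborel. f (fst p) * g (snd p)) = (LINT t|lborel. f t) * (LINT s|lborel. g s)"
    using lborel_pair.integral_fst'[OF int] by (simp add: lborel_prod)
qed

text \<open>The integral runs over the whole plane with arbitrary weights; in use these vanish off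
  (0, 1), so reflecting a variable is mere precomposition of its weight.\<close>

definition appell_integral ::
  "complex \<Rightarrow> (real \<Rightarrow> complex) \<Rightarrow> (real \<Rightarrow> complex) \<Rightarrow> complex \<Rightarrow> complex \<Rightarrow> complex" where
  "appell_integral \<alpha> u v x y =
     (LINT p|lborel. u (fst p) * v (snd p)
        * (1 - x * of_real (fst p) - y * of_real (snd p)) powr (-\<alpha>))"

text \<open>On (0, 1) the monomials are at most 1, so each term is dominated by its coefficient
  times the integrable function \<open>norm (u t * v s)\<close>. The coefficients being absolutely
  summable, sum and integral may be exchanged.\<close>

lemma appell_integral_series:
  fixes u v :: "real \<Rightarrow> complex"
  assumes u: "integrable lborel u" "\<And>t. t \<notin> {0<..<1} \<Longrightarrow> u t = 0"
    and v: "integrable lborel v" "\<And>s. s \<notin> {0<..<1} \<Longrightarrow> v s = 0"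
    and xy: "norm x + norm y < 1"
  shows "((\<lambda>(m, n). pochhammer \<alpha> (m + n) * (x ^ m * y ^ n / (fact m * fact n))
            * ((LINT t|lborel. of_real t ^ m * u t) * (LINT s|lborel. of_real s ^ n * v s)))
          has_sum appell_integral \<alpha> u v x y) UNIV"
proof -
  define C where
    "C = (\<lambda>(m, n). pochhammer \<alpha> (m + n) * (x ^ m * y ^ n / (fact m * fact n)))"
  define U where "U = (\<lambda>m t. complex_of_real t ^ m * u t)"
  define V where "V = (\<lambda>n s. complex_of_real s ^ n * v s)"
  define F where "F = (\<lambda>(m, n) p. C (m, n) * (U m (fst p) * V n (snd p)))"
  define B where "B = (LINT p|lborel. norm (u (fst p) * v (snd p)))"
  have moment: "integrable lborel (\<lambda>t. complex_of_real t ^ m * h t)"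
    and moment_le: "norm (complex_of_real t ^ m * h t) \<le> norm (h t)"
    if h: "integrable lborel h" "\<And>t. t \<notin> {0<..<1} \<Longrightarrow> h t = 0"
    for h :: "real \<Rightarrow> complex" and m t
  proof -
    \<comment> \<open>Powers of \<open>t\<close> are unbounded on the line, but \<open>h\<close>
      vanishes where they could exceed 1.\<close>
    have le: "norm (complex_of_real t ^ m * h t) \<le> norm (h t)" for t
    proof (cases "t \<in> {0<..<1}")
      case True
      then have "\<bar>t\<bar> ^ m \<le> 1" by (intro power_le_one) auto
      then show ?thesis by (simp add: norm_mult norm_power mult_left_le_one_le)
    qed (use h in auto)
    then show "norm (complex_of_real t ^ m * h t) \<le> norm (h t)" .
    have [measurable]: "h \<in> borel_measurable borel"
      using h(1) by (auto dest: borel_measurable_integrable)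
    show "integrable lborel (\<lambda>t. complex_of_real t ^ m * h t)"
      by (rule Bochner_Integration.integrable_bound[OF h(1)]) (use le in auto)
  qed
  have U: "integrable lborel (U m)" "norm (U m t) \<le> norm (u t)" for m t
    unfolding U_def using moment moment_le u by auto
  have V: "integrable lborel (V n)" "norm (V n s) \<le> norm (v s)" for n s
    unfolding V_def using moment moment_le v by auto
  have intF: "integrable lborel (F q)" for q
    unfolding F_def
    by (cases q) (auto intro!: integrable_lborel_times U V)
  have F_le: "norm (F q p) \<le> norm (C q) * norm (u (fst p) * v (snd p))" for q p
    unfolding F_def by (cases q) (auto simp: norm_mult intro!: mult_mono U V)
  have uv: "integrable lborel (\<lambda>p. u (fst p) * v (snd p))"
    by (intro integrable_lborel_times u v)
  have absC: "(\<lambda>q. norm (C q)) summable_on UNIV"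
    unfolding C_def by (rule abs_summable_appell_kernel[OF xy])
  \<comment> \<open>The pairs are enumerated by \<open>prod_decode\<close>, since
    \<open>sums_integral\<close> treats series indexed by the naturals.\<close>
  have sumC: "summable (\<lambda>i. norm (C (prod_decode i)))"
    by (rule summable_on_imp_summable)
       (use absC in \<open>simp add: summable_on_reindex_bij_betw[OF bij_prod_decode, of "\<lambda>q. norm (C q)"]\<close>)
  have pointwise: "((\<lambda>q. F q p) has_sum u (fst p) * v (snd p)
      * (1 - x * of_real (fst p) - y * of_real (snd p)) powr (-\<alpha>)) UNIV" for p
  proof (cases "fst p \<in> {0<..<1} \<and> snd p \<in> {0<..<1}")
    case True
    \<comment> \<open>Inside the square, the kernel expansion applies at \<open>z = x t\<close>,
      \<open>w = y s\<close>; outside it, every term and the limit are 0.\<close>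
    have "norm x * \<bar>fst p\<bar> + norm y * \<bar>snd p\<bar> \<le> norm x * 1 + norm y * 1"
      using True by (intro add_mono mult_left_mono) auto
    then have "norm (x * of_real (fst p)) + norm (y * of_real (snd p)) < 1"
      using xy by (simp add: norm_mult)
    from has_sum_cmult_right[OF has_sum_appell_kernel[OF this, of \<alpha>],
        of "u (fst p) * v (snd p)"]
    show ?thesis
      by (rule has_sum_cong[THEN iffD1, rotated])
         (auto simp: F_def C_def U_def V_def power_mult_distrib)
  next
    case False
    then have uv: "u (fst p) * v (snd p) = 0" using u(2) v(2) by auto
    then have "F q p = 0" for q
      by (cases q) (auto simp: F_def U_def V_def)
    then show ?thesis by (simp only: uv mult_zero_left has_sum_0_simp)
  qed
  have int_le: "(LINT p|lborel. norm (F q p)) \<le> norm (C q) * B" for q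
  proof -
    have "(LINT p|lborel. norm (F q p)) \<le> (LINT p|lborel. norm (C q) * norm (u (fst p) * v (snd p)))"
      by (intro integral_mono) (use intF uv F_le in auto)
    then show ?thesis by (simp add: B_def)
  qed
  have sumB: "summable (\<lambda>i. norm (C (prod_decode i)) * B)"
    by (rule summable_mult2[OF sumC])
  have "(\<lambda>i. LINT p|lborel. F (prod_decode i) p)
      sums (LINT p|lborel. (\<Sum>i. F (prod_decode i) p))"
  proof (rule sums_integral)
    show "integrable lborel (F (prod_decode i))" for i by (rule intF)
    have "summable (\<lambda>i. norm (F (prod_decode i) p))" for p
      by (rule summable_comparison_test'[OF summable_mult2[OF sumC]])
         (simp only: real_norm_def abs_norm_cancel, rule F_le)
    then show "AE p in lborel. summable (\<lambda>i. norm (F (prod_decode i) p))" by simp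
    show "summable (\<lambda>i. LINT p|lborel. norm (F (prod_decode i) p))"
      by (rule summable_comparison_test'[OF sumB]) (use int_le in auto)
  qed
  moreover have "(\<Sum>i. F (prod_decode i) p) = u (fst p) * v (snd p)
      * (1 - x * of_real (fst p) - y * of_real (snd p)) powr (-\<alpha>)" for p
    using pointwise[of p]
    by (subst (asm) has_sum_reindex_bij_betw[OF bij_prod_decode, symmetric])
       (simp add: has_sum_imp_sums sums_unique[symmetric])
  ultimately have "(\<lambda>i. LINT p|lborel. F (prod_decode i) p) sums appell_integral \<alpha> u v x y"
    by (simp add: appell_integral_def)
  \<comment> \<open>Absolute summability turns the enumerated series back into an unordered
    sum.\<close>
  moreover have "summable (\<lambda>i. norm (LINT p|lborel. F (prod_decode i) p))"
    by (rule summable_comparison_test'[OF sumB])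
       (simp only: real_norm_def abs_norm_cancel, rule order.trans[OF integral_norm_bound int_le])
  ultimately have "((\<lambda>i. LINT p|lborel. F (prod_decode i) p) has_sum appell_integral \<alpha> u v x y) UNIV"
    by (intro norm_summable_imp_has_sum)
  then have "((\<lambda>q. LINT p|lborel. F q p) has_sum appell_integral \<alpha> u v x y) UNIV"
    by (subst (asm) has_sum_reindex_bij_betw[OF bij_prod_decode])
  moreover have "(LINT p|lborel. F q p) = (case q of (m, n) \<Rightarrow>
      C (m, n) * ((LINT t|lborel. U m t) * (LINT s|lborel. V n s)))" for q
    by (cases q) (simp add: F_def integral_lborel_times U V)
  ultimately show ?thesis by (simp add: C_def U_def V_def)
qed

section \<open>Measure-preserving substitutions\<close>

text \<open>Plane Lebesgue measure is a product measure, so each variable can be reflected or kept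
  independently of the other.\<close>

lemma distr_lborel_pair:
  fixes \<phi> \<psi> :: "real \<Rightarrow> real"
  assumes [measurable]: "\<phi> \<in> borel_measurable borel" "\<psi> \<in> borel_measurable borel"
    and \<phi>: "distr lborel borel \<phi> = lborel" and \<psi>: "distr lborel borel \<psi> = lborel"
  shows "distr lborel borel (\<lambda>p. (\<phi> (fst p), \<psi> (snd p))) = lborel"
proof -
  have "distr lborel borel \<phi> \<Otimes>\<^sub>M distr lborel borel \<psi>
      = distr (lborel \<Otimes>\<^sub>M lborel) (borel \<Otimes>\<^sub>M borel) (\<lambda>(t, s). (\<phi> t, \<psi> s))"
    by (rule pair_measure_distr) (simp_all add: \<psi> sigma_finite_lborel)
  then show ?thesis
    by (simp add: \<phi> \<psi> lborel_prod borel_prod case_prod_unfold)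
qed

lemma distr_lborel_reflect: "distr lborel borel (\<lambda>t::real. 1 - t) = lborel"
  using lborel_real_affine[of "-1" 1] by (simp add: density_1)

lemma appell_integral_substitution:
  fixes u v :: "real \<Rightarrow> complex" and \<phi> \<psi> :: "real \<Rightarrow> real"
  assumes [measurable]: "u \<in> borel_measurable borel" "v \<in> borel_measurable borel"
    and supp: "\<And>t. t \<notin> {0<..<1} \<Longrightarrow> u t = 0" "\<And>s. s \<notin> {0<..<1} \<Longrightarrow> v s = 0"
    and [measurable]: "\<phi> \<in> borel_measurable borel" "\<psi> \<in> borel_measurable borel"
    and distr: "distr lborel borel \<phi> = lborel" "distr lborel borel \<psi> = lborel"
    and xy: "norm x + norm y < 1" and c: "Re c > 0"
    and affine: "\<And>t s. 1 - x * of_real (\<phi> t) - y * of_real (\<psi> s)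
                   = c * (1 - x' * of_real t - y' * of_real s)"
  shows "appell_integral \<alpha> u v x y
           = c powr (-\<alpha>) * appell_integral \<alpha> (\<lambda>t. u (\<phi> t)) (\<lambda>s. v (\<psi> s)) x' y'"
proof -
  define S :: "(real \<times> real) set" where "S = {0<..<1} \<times> {0<..<1}"
  define K where "K = (\<lambda>p. (1 - x * of_real (fst p) - y * of_real (snd p)) powr (-\<alpha>))"
  have pos: "Re (1 - x * of_real (fst p) - y * of_real (snd p)) > 0" if "p \<in> S" for p
    using that by (intro Re_one_minus_pos[OF xy]) (auto simp: S_def)
  \<comment> \<open>The power is known to avoid its branch cut only on the square. Cutting
    \<open>K\<close> off there makes it Borel and leaves \<open>G\<close> unchanged, because the
    weights vanish elsewhere.\<close>
  have "continuous_on S K"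
    unfolding K_def
    by (intro continuous_intros)
       (use pos in \<open>fastforce simp: complex_nonpos_Reals_iff\<close>)+
  moreover have "S \<in> sets borel"
    unfolding S_def by (intro borel_open open_Times) auto
  ultimately have indicator_K: "(\<lambda>p. indicator S p *\<^sub>R K p) \<in> borel_measurable borel"
    by (intro borel_measurable_continuous_on_indicator)
  define G where "G = (\<lambda>p. u (fst p) * v (snd p) * K p)"
  have "G = (\<lambda>p. u (fst p) * v (snd p) * (indicator S p *\<^sub>R K p))"
    using supp by (auto simp: G_def S_def indicator_def fun_eq_iff mem_Times_iff)
  moreover have "(\<lambda>p. u (fst p) * v (snd p)) \<in> borel_measurable (borel \<Otimes>\<^sub>M borel)"
    by measurable
  then have "(\<lambda>p. u (fst p) * v (snd p) * (indicator S p *\<^sub>R K p)) \<in> borel_measurable borel"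
    unfolding borel_prod using indicator_K by (rule borel_measurable_times)
  ultimately have [measurable]: "G \<in> borel_measurable borel" by simp
  have "(\<lambda>p. (\<phi> (fst p), \<psi> (snd p))) \<in> borel \<Otimes>\<^sub>M borel \<rightarrow>\<^sub>M borel \<Otimes>\<^sub>M borel"
    by measurable
  then have measurable_pair:
    "(\<lambda>p. (\<phi> (fst p), \<psi> (snd p))) \<in> borel \<rightarrow>\<^sub>M (borel :: (real \<times> real) measure)"
    by (simp only: borel_prod)
  have "appell_integral \<alpha> u v x y = integral\<^sup>L (distr lborel borel (\<lambda>p. (\<phi> (fst p), \<psi> (snd p)))) G"
    by (simp add: distr_lborel_pair distr appell_integral_def G_def K_def)
  also have "\<dots> = (LINT p|lborel. G (\<phi> (fst p), \<psi> (snd p)))"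
    using measurable_pair by (subst integral_distr) simp_all
  also have "\<dots> = (LINT p|lborel. c powr (-\<alpha>) * (u (\<phi> (fst p)) * v (\<psi> (snd p))
      * (1 - x' * of_real (fst p) - y' * of_real (snd p)) powr (-\<alpha>)))"
  proof (rule Bochner_Integration.integral_cong[OF refl])
    fix p :: "real \<times> real"
    show "G (\<phi> (fst p), \<psi> (snd p)) = c powr (-\<alpha>) * (u (\<phi> (fst p)) * v (\<psi> (snd p))
      * (1 - x' * of_real (fst p) - y' * of_real (snd p)) powr (-\<alpha>))"
    \<comment> \<open>If the image point is in \<open>S\<close>, both \<open>c\<close> and the
      product in \<open>affine\<close> have positive real part and the power splits; otherwise a
      weight annihilates both sides.\<close>
    proof (cases "(\<phi> (fst p), \<psi> (snd p)) \<in> S")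
      case True
      show ?thesis
        using pos[OF True] powr_mult_Re_pos[OF c] by (simp add: G_def K_def affine)
    next
      case False
      then have "u (\<phi> (fst p)) = 0 \<or> v (\<psi> (snd p)) = 0" using supp by (auto simp: S_def)
      then show ?thesis by (auto simp: G_def)
    qed
  qed
  finally show ?thesis by (simp add: appell_integral_def)
qed

section \<open>Beta weights and the Euler representation\<close>

definition beta_weight ::
  "(complex \<Rightarrow> complex) \<Rightarrow> complex \<Rightarrow> complex \<Rightarrow> complex \<Rightarrow> complex \<Rightarrow> real \<Rightarrow> complex" where
  "beta_weight \<Theta> b d \<alpha> \<beta> t = indicator {0<..<1} t *\<^sub>R ext_beta_integrand \<Theta> b d \<alpha> \<beta> t"

lemma beta_weight_eq_0: "t \<notin> {0<..<1} \<Longrightarrow> beta_weight \<Theta> b d \<alpha> \<beta> t = 0"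
  by (simp add: beta_weight_def)

text \<open>Reflection exchanges \<open>b\<close> with \<open>d\<close> as well as the exponents, so
  the family with fixed parameters is preserved exactly in the form needed when
  \<open>d = b\<close>.\<close>

lemma beta_weight_reflect: "beta_weight \<Theta> b d \<alpha> \<beta> (1 - t) = beta_weight \<Theta> d b \<beta> \<alpha> t"
proof -
  have "\<Theta> (- (b / (1 - of_real t)) - d / of_real t) = \<Theta> (- (d / of_real t) - b / (1 - of_real t))"
    by (rule arg_cong[where f = \<Theta>]) simp
  then show ?thesis
    by (auto simp: beta_weight_def ext_beta_integrand_def indicator_def mult_ac)
qed

text \<open>Raising the first exponent by \<open>m\<close> multiplies the integrand by
  \<open>t ^ m\<close>, as \<open>t\<close> is positive. This matches the series coefficients with
  the moments in \<open>appell_integral_series\<close>.\<close>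

lemma ext_beta_moment:
  "ext_beta \<Theta> b d (\<alpha> + of_nat m) \<beta> = (LINT t|lborel. of_real t ^ m * beta_weight \<Theta> b d \<alpha> \<beta> t)"
  unfolding ext_beta_def set_lebesgue_integral_def
proof (rule Bochner_Integration.integral_cong[OF refl])
  fix t :: real
  have "complex_of_real t powr (\<alpha> + of_nat m - 1) = of_real t ^ m * of_real t powr (\<alpha> - 1)"
    if "t \<in> {0<..<1}"
  proof -
    have "complex_of_real t powr (of_nat m + (\<alpha> - 1)) = of_real t ^ m * of_real t powr (\<alpha> - 1)"
      using that by (subst powr_add) (simp add: powr_nat')
    then show ?thesis by (simp add: algebra_simps)
  qed
  then show "indicator {0<..<1} t *\<^sub>R ext_beta_integrand \<Theta> b d (\<alpha> + of_nat m) \<beta> t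
      = of_real t ^ m * beta_weight \<Theta> b d \<alpha> \<beta> t"
    by (auto simp: beta_weight_def ext_beta_integrand_def indicator_def)
qed

text \<open>Transformed arguments can fall into either branch of the definition, so one formula is
  needed for both: termwise integration handles the series, and the identification of
  \<open>appell_power\<close> with the principal power handles the integral.\<close>

lemma ext_appell_F2_euler:
  assumes nv: "appell_nonvanishing x y"
    and int: "integrable lborel (beta_weight \<Theta> b d \<beta>\<^sub>1 (\<gamma>\<^sub>1 - \<beta>\<^sub>1))"
      "integrable lborel (beta_weight \<Theta> b d \<beta>\<^sub>2 (\<gamma>\<^sub>2 - \<beta>\<^sub>2))"
  shows "ext_appell_F2 \<Theta> \<alpha> \<beta>\<^sub>1 \<beta>\<^sub>2 \<gamma>\<^sub>1 \<gamma>\<^sub>2 x y b d =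
    1 / (Beta \<beta>\<^sub>1 (\<gamma>\<^sub>1 - \<beta>\<^sub>1) * Beta \<beta>\<^sub>2 (\<gamma>\<^sub>2 - \<beta>\<^sub>2))
    * appell_integral \<alpha> (beta_weight \<Theta> b d \<beta>\<^sub>1 (\<gamma>\<^sub>1 - \<beta>\<^sub>1)) (beta_weight \<Theta> b d \<beta>\<^sub>2 (\<gamma>\<^sub>2 - \<beta>\<^sub>2)) x y"
proof (cases "norm x + norm y < 1")
  case True
  let ?c = "1 / (Beta \<beta>\<^sub>1 (\<gamma>\<^sub>1 - \<beta>\<^sub>1) * Beta \<beta>\<^sub>2 (\<gamma>\<^sub>2 - \<beta>\<^sub>2))"
  note hs = has_sum_cmult_right[OF appell_integral_series[OF int(1) beta_weight_eq_0 int(2)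
        beta_weight_eq_0 True, of \<alpha>], of ?c]
  show ?thesis
    unfolding ext_appell_F2_def if_P[OF True]
    by (rule infsumI, rule has_sum_cong[THEN iffD1, OF _ hs]) (auto simp: ext_beta_moment mult_ac)
next
  case False
  have "(LINT (t, s):{0<..<1} \<times> {0<..<1}|lborel.
             of_real t powr (\<beta>\<^sub>1 - 1) * of_real (1 - t) powr (\<gamma>\<^sub>1 - \<beta>\<^sub>1 - 1)
             * of_real s powr (\<beta>\<^sub>2 - 1) * of_real (1 - s) powr (\<gamma>\<^sub>2 - \<beta>\<^sub>2 - 1)
             / appell_power \<alpha> x y t s
             * \<Theta> (- (b / of_real t) - d / of_real (1 - t))
             * \<Theta> (- (b / of_real s) - d / of_real (1 - s)))
      = appell_integral \<alpha> (beta_weight \<Theta> b d \<beta>\<^sub>1 (\<gamma>\<^sub>1 - \<beta>\<^sub>1)) (beta_weight \<Theta> b d \<beta>\<^sub>2 (\<gamma>\<^sub>2 - \<beta>\<^sub>2)) x y"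
    unfolding appell_integral_def set_lebesgue_integral_def
  proof (rule Bochner_Integration.integral_cong[OF refl], goal_cases)
    case (1 p)
    show ?case
    proof (cases "p \<in> {0<..<1} \<times> {0<..<1}")
      case True
      then show ?thesis
        by (cases p)
           (simp add: beta_weight_def ext_beta_integrand_def appell_power_eq_powr[OF nv]
             powr_minus divide_inverse mult_ac)
    next
      case False
      then show ?thesis by (cases p) (auto simp: beta_weight_def)
    qed
  qed
  then show ?thesis
    unfolding ext_appell_F2_def using False by simp
qed

section \<open>The three transformation formulas\<close>

theorem theorem3p3:
  fixes \<kappa> :: "nat \<Rightarrow> complex" and \<Theta> :: "complex \<Rightarrow> complex"
    and R M\<^sub>0 :: real and \<omega> :: complex
    and \<alpha> \<beta> \<beta>' \<gamma> \<gamma>' x y b :: complex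
  assumes "\<kappa> 0 = 1"
    and "R > 0"
    and "\<And>z. norm z < R \<Longrightarrow> (\<lambda>l. \<kappa> l * z ^ l / fact l) sums \<Theta> z"
    and "\<Theta> holomorphic_on (ball 0 R \<union> {z. Re z > 0})"
    and "M\<^sub>0 > 0"
    and "(\<lambda>z. \<Theta> z / (of_real M\<^sub>0 * z powr \<omega> * exp z) - 1) \<in> O[filtercomap Re at_top](\<lambda>z. 1 / z)"
    and "continuous_on {z. Re z \<le> 0} \<Theta>"
    and "set_integrable lborel {0<..<1} (ext_beta_integrand \<Theta> b b \<beta> (\<gamma> - \<beta>))"
    and "set_integrable lborel {0<..<1} (ext_beta_integrand \<Theta> b b \<beta>' (\<gamma>' - \<beta>'))"
    and "norm x + norm y < 1"
    and "Re \<gamma> > Re \<beta>" and "Re \<beta> > 0"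
    and "Re \<gamma>' > Re \<beta>'" and "Re \<beta>' > 0"
    and "Re b \<ge> 0"
  shows "ext_appell_F2 \<Theta> \<alpha> \<beta> \<beta>' \<gamma> \<gamma>' x y b b =
           (1 - x) powr (- \<alpha>)
           * ext_appell_F2 \<Theta> \<alpha> (\<gamma> - \<beta>) \<beta>' \<gamma> \<gamma>' (x / (x - 1)) (- y / (x - 1)) b b
       \<and> ext_appell_F2 \<Theta> \<alpha> \<beta> \<beta>' \<gamma> \<gamma>' x y b b =
           (1 - y) powr (- \<alpha>)
           * ext_appell_F2 \<Theta> \<alpha> \<beta> (\<gamma>' - \<beta>') \<gamma> \<gamma>' (- x / (y - 1)) (y / (y - 1)) b b
       \<and> ext_appell_F2 \<Theta> \<alpha> \<beta> \<beta>' \<gamma> \<gamma>' x y b b =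
           (1 - x - y) powr (- \<alpha>)
           * ext_appell_F2 \<Theta> \<alpha> (\<gamma> - \<beta>) (\<gamma>' - \<beta>') \<gamma> \<gamma>'
               (- x / (1 - x - y)) (- y / (1 - x - y)) b b"
proof -
  let ?u = "beta_weight \<Theta> b b \<beta> (\<gamma> - \<beta>)" and ?v = "beta_weight \<Theta> b b \<beta>' (\<gamma>' - \<beta>')"
  have u: "integrable lborel ?u" and v: "integrable lborel ?v"
    using assms(8,9) by (simp_all add: set_integrable_def beta_weight_def[abs_def])
  \<comment> \<open>The exponent \<beta> is written as
    \<open>\<gamma> - (\<gamma> - \<beta>)\<close> to fit the Euler representation with first
    parameter \<open>\<gamma> - \<beta>\<close>.\<close>
  have u_refl: "(\<lambda>t. ?u (1 - t)) = beta_weight \<Theta> b b (\<gamma> - \<beta>) (\<gamma> - (\<gamma> - \<beta>))"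
    and v_refl: "(\<lambda>t. ?v (1 - t)) = beta_weight \<Theta> b b (\<gamma>' - \<beta>') (\<gamma>' - (\<gamma>' - \<beta>'))"
    by (simp_all add: beta_weight_reflect)
  have u': "integrable lborel (\<lambda>t. ?u (1 - t))" and v': "integrable lborel (\<lambda>t. ?v (1 - t))"
    using lborel_integrable_real_affine[OF u, of "-1" 1] lborel_integrable_real_affine[OF v, of "-1" 1]
    by simp_all
  have meas: "?u \<in> borel_measurable borel" "?v \<in> borel_measurable borel"
    using u v by (auto dest: borel_measurable_integrable)
  have id: "distr lborel borel (\<lambda>t::real. t) = lborel"
    by (rule distr_id2) simp
  have subst: "appell_integral \<alpha> ?u ?v x y
      = c powr (-\<alpha>) * appell_integral \<alpha> (\<lambda>t. ?u (\<phi> t)) (\<lambda>s. ?v (\<psi> s)) x' y'"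
    if "\<phi> \<in> borel_measurable borel" "\<psi> \<in> borel_measurable borel"
      "distr lborel borel \<phi> = lborel" "distr lborel borel \<psi> = lborel" "Re c > 0"
      "\<And>t s. 1 - x * of_real (\<phi> t) - y * of_real (\<psi> s) = c * (1 - x' * of_real t - y' * of_real s)"
    for \<phi> \<psi> c x' y'
    by (rule appell_integral_substitution[OF meas _ _ that(1-4) assms(10) that(5,6)])
       (simp_all add: beta_weight_eq_0)
  note pos = Re_one_minus_pos[OF assms(10)]
  \<comment> \<open>Up to the factor \<open>c\<close>, the new linear form takes values of the old
    one on the square, where the real part is positive; it therefore has no zero there.\<close>
  have nonvanishing: "appell_nonvanishing x' y'"
    if "\<And>t s. 1 - x * of_real (\<phi> t) - y * of_real (\<psi> s) = c * (1 - x' * of_real t - y' * of_real s)"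
      "\<phi> ` {0..1} \<subseteq> {0..1}" "\<psi> ` {0..1} \<subseteq> {0..1}" for x' y' c and \<phi> \<psi> :: "real \<Rightarrow> real"
    unfolding appell_nonvanishing_def
  proof safe
    fix t s :: real
    assume ts: "t \<in> {0..1}" "s \<in> {0..1}" and 0: "1 - x' * of_real t - y' * of_real s = 0"
    have "\<phi> t \<in> {0..1}" "\<psi> s \<in> {0..1}" using that(2,3) ts by blast+
    from pos[OF this] show False unfolding that(1) 0 by simp
  qed
  \<comment> \<open>The three prefactors are the values of the linear form at the other corners of
    the square.\<close>
  have c1: "Re (1 - x) > 0" using pos[of 1 0] by simp
  have c2: "Re (1 - y) > 0" using pos[of 0 1] by simp
  have c3: "Re (1 - x - y) > 0" using pos[of 1 1] by simp
  have nz: "1 - x \<noteq> 0" "x - 1 \<noteq> 0" "1 - y \<noteq> 0" "y - 1 \<noteq> 0" "1 - x - y \<noteq> 0"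
    using c1 c2 c3 by auto
  have affine: "c * (1 - p / c * t - q / c * s) = c - p * t - q * s" if "c \<noteq> 0"
    for c p q t s :: complex
    using that by (simp add: right_diff_distrib)
  \<comment> \<open>Brings the denominators \<open>x - 1\<close> and \<open>y - 1\<close> to the
    constant \<open>c\<close> that is factored out.\<close>
  have flip: "z / (w - 1) = - z / (1 - w)" for z w :: complex
    by (metis minus_diff_eq minus_divide_left minus_divide_right)
  have e1: "1 - x * of_real (1 - t) - y * of_real s
      = (1 - x) * (1 - x / (x - 1) * of_real t - - y / (x - 1) * of_real s)" for t s
    unfolding flip affine[OF nz(1)] by (simp add: algebra_simps)
  have e2: "1 - x * of_real t - y * of_real (1 - s)
      = (1 - y) * (1 - - x / (y - 1) * of_real t - y / (y - 1) * of_real s)" for t s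
    unfolding flip affine[OF nz(3)] by (simp add: algebra_simps)
  have e3: "1 - x * of_real (1 - t) - y * of_real (1 - s)
      = (1 - x - y) * (1 - - x / (1 - x - y) * of_real t - - y / (1 - x - y) * of_real s)" for t s
    unfolding flip affine[OF nz(5)] by (simp add: algebra_simps)
  note lhs = ext_appell_F2_euler[OF appell_nonvanishing_unit[OF assms(10)] u v, of \<alpha>]
  \<comment> \<open>In each formula, the normalising factors of the two sides agree by the symmetry
    of \<open>Beta\<close>.\<close>
  have 1: "ext_appell_F2 \<Theta> \<alpha> \<beta> \<beta>' \<gamma> \<gamma>' x y b b =
      (1 - x) powr (- \<alpha>)
      * ext_appell_F2 \<Theta> \<alpha> (\<gamma> - \<beta>) \<beta>' \<gamma> \<gamma>' (x / (x - 1)) (- y / (x - 1)) b b"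
    unfolding lhs
    by (subst ext_appell_F2_euler[OF nonvanishing[OF e1] u'[unfolded u_refl] v])
       (auto simp: subst[OF _ _ distr_lborel_reflect id c1 e1] u_refl Beta_commute)
  have 2: "ext_appell_F2 \<Theta> \<alpha> \<beta> \<beta>' \<gamma> \<gamma>' x y b b =
      (1 - y) powr (- \<alpha>)
      * ext_appell_F2 \<Theta> \<alpha> \<beta> (\<gamma>' - \<beta>') \<gamma> \<gamma>' (- x / (y - 1)) (y / (y - 1)) b b"
    unfolding lhs
    by (subst ext_appell_F2_euler[OF nonvanishing[OF e2] u v'[unfolded v_refl]])
       (auto simp: subst[OF _ _ id distr_lborel_reflect c2 e2] v_refl Beta_commute)
  have 3: "ext_appell_F2 \<Theta> \<alpha> \<beta> \<beta>' \<gamma> \<gamma>' x y b b =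
      (1 - x - y) powr (- \<alpha>)
      * ext_appell_F2 \<Theta> \<alpha> (\<gamma> - \<beta>) (\<gamma>' - \<beta>') \<gamma> \<gamma>'
          (- x / (1 - x - y)) (- y / (1 - x - y)) b b"
    unfolding lhs
    by (subst ext_appell_F2_euler[OF nonvanishing[OF e3] u'[unfolded u_refl] v'[unfolded v_refl]])
       (auto simp: subst[OF _ _ distr_lborel_reflect distr_lborel_reflect c3 e3] u_refl v_refl Beta_commute)
  show ?thesis using 1 2 3 by blast
qed

end
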